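(* Let $s\in\mathbb N$ and $f\in C^\infty([0,1]^s)$ satisfy, for some $K,\alpha>0$ and a finite collection $\mathcal J$ of subsets of $\{1,\dots,s\}$, $\|f^{|\boldsymbol\kappa|}\|_1\le K\alpha^{\|\boldsymbol\kappa\|_0}\max_{J\in\mathcal J}\prod_{j\in J}(|\kappa_j|)!$ for all $\boldsymbol k\in\mathbb N_0^s$; let $\mathcal J_{\max}=\max_{J\in\mathcal J}|J|$. Let $D$ be a constant (depending on $s,\alpha,\mathcal J_{\max}$) and $T_m=K2^{-N_m+2\mathcal J_{\max}\log_2(m)\sqrt{\lambda N_m/s}+Dm}$. For $T\ge0$ let $\Lambda(T)=\{\boldsymbol k\in\mathbb N_*^s:|\hat f(\boldsymbol k)|\ge T\}$ and suppose $$\liminf_{m\to\infty}\frac{|Q_{N_m}\cap\Lambda(T_m)|}{|Q_{N_m}|}>0.$$ Let $\mathrm{SUM}'_{1,m}=\sum_{\boldsymbol k\in Q_{N_m}}Z(\boldsymbol k)S'(\boldsymbol k)\hat f(\boldsymbol k)$, where the $S'(\boldsymbol k)$ are i.i.d. uniform on $\{-1,1\}$ independent of everything else. Then under the complete random design, $$\limsup_{m\to\infty}\sqrt m\,\Pr(|\mathrm{SUM}'_{1,m}|\le T_m)<\infty.$$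
   Context: Binary digits: for $k\in\mathbb N_0$, $k=\sum_{\ell\ge1}a_\ell2^{\ell-1}$, $\vec k=(a_1,a_2,\dots)$, $\kappa=\{\ell:a_\ell=1\}$; $\vec x$ the binary digits of $x\in[0,1)$. For $\boldsymbol k\in\mathbb N_0^s$ with digit sets $\boldsymbol\kappa$, $\|\boldsymbol\kappa\|_1=\sum_j\sum_{\ell\in\kappa_j}\ell$, $\|\boldsymbol\kappa\|_0=\sum_j|\kappa_j|$; $\mathbb N_*^s=\mathbb N_0^s\setminus\{\boldsymbol0\}$, $Q_N=\{\boldsymbol k\in\mathbb N_*^s:\|\boldsymbol\kappa\|_1\le N\}$; $\hat f(\boldsymbol k)=\int f(\boldsymbol x)(-1)^{\sum_j\vec k_j^{\mathsf T}\vec x_j}\mathrm d\boldsymbol x$; $f^{|\boldsymbol\kappa|}=\partial^{\|\boldsymbol\kappa\|_0}f/\partial x_1^{|\kappa_1|}\cdots\partial x_s^{|\kappa_s|}$; $\|\cdot\|_1$ the $L^1$ norm; empty products are $1$. $\oplus$ is componentwise bitwise XOR on $\mathbb N_0^s$; $\lambda=3(\log2)^2/\pi^2$. Constants: $A_s,B_s>0$ depend only on $s$ and satisfy: for all $N\ge1$, $r\ge2$, if $\boldsymbol k_1,\dots,\boldsymbol k_r$ are i.i.d. uniform on $Q_N$ then $\Pr(\oplus_i\boldsymbol k_i\in Q_N)\le A_s^rN^{r/4}r^{-B_s\sqrt N}$; $c_s=\frac14B_s\sqrt{\lambda/s}$, $N_m=\sup\{N\in\mathbb N_0:|Q_N|\le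 c_sm2^m\}$. Complete random design: $C_j\in\{0,1\}^{\infty\times m}$ ($j=1,\dots,s$) with all entries i.i.d. uniform on $\{0,1\}$; $Z(\boldsymbol k)=\mathbf 1\{\sum_j\sum_{\ell\in\kappa_j}C_j(\ell,:)=\boldsymbol0\bmod2\}$. *)

theory Defs
  imports "HOL-Analysis.Analysis" "HOL-Probability.Probability"
begin

definition kappa :: "nat \<Rightarrow> nat set" where
  "kappa k = {l. l \<ge> 1 \<and> odd (k div 2 ^ (l - 1))}"

definition xdigit :: "real \<Rightarrow> nat \<Rightarrow> nat" where
  "xdigit x l = nat (\<lfloor>2 ^ l * x\<rfloor>) mod 2"

definition norm1 :: "nat^'n::finite \<Rightarrow> nat" where
  "norm1 k = (\<Sum>j\<in>UNIV. \<Sum>l\<in>kappa (k $ j). l)"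

definition norm0 :: "nat^'n::finite \<Rightarrow> nat" where
  "norm0 k = (\<Sum>j\<in>UNIV. card (kappa (k $ j)))"

definition Q :: "nat \<Rightarrow> (nat^'n::finite) set" where
  "Q N = {k. k \<noteq> 0 \<and> norm1 k \<le> N}"

definition vec_xor :: "nat^'n::finite \<Rightarrow> nat^'n \<Rightarrow> nat^'n" where
  "vec_xor a b = (\<chi> j. xor (a $ j) (b $ j))"

definition xor_sum :: "nat \<Rightarrow> (nat \<Rightarrow> nat^'n::finite) \<Rightarrow> nat^'n" where
  "xor_sum r ks = foldr (\<lambda>i acc. vec_xor (ks i) acc) [0..<r] 0"

definition lambda_c :: real where
  "lambda_c = 3 * (ln 2)^2 / pi^2"

definition c_s :: "'n::finite itself \<Rightarrow> real \<Rightarrow> real" where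
  "c_s _ B = B / 4 * sqrt (lambda_c / real CARD('n))"

definition Nm :: "'n::finite itself \<Rightarrow> real \<Rightarrow> nat \<Rightarrow> nat" where
  "Nm T B m = Sup {N. real (card (Q N :: (nat^'n) set)) \<le> c_s T B * real m * 2 ^ m}"

definition walsh :: "nat^'n::finite \<Rightarrow> real^'n \<Rightarrow> real" where
  "walsh k x = (-1) ^ (\<Sum>j\<in>UNIV. \<Sum>l\<in>kappa (k $ j). xdigit (x $ j) l)"

definition fhat :: "(real^'n::finite \<Rightarrow> real) \<Rightarrow> nat^'n \<Rightarrow> real" where
  "fhat f k = (LINT x : cbox 0 One | lborel. f x * walsh k x)"

definition Lambda :: "(real^'n::finite \<Rightarrow> real) \<Rightarrow> real \<Rightarrow> (nat^'n) set" where
  "Lambda f T = {k. k \<noteq> 0 \<and> \<bar>fhat f k\<bar> \<ge> T}"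

definition pd :: "'n::finite \<Rightarrow> (real^'n \<Rightarrow> real) \<Rightarrow> real^'n \<Rightarrow> real" where
  "pd i g x = deriv (\<lambda>t. g (x + t *\<^sub>R axis i 1)) 0"

fun iter_pd :: "'n::finite list \<Rightarrow> (real^'n \<Rightarrow> real) \<Rightarrow> real^'n \<Rightarrow> real" where
  "iter_pd [] g = g"
| "iter_pd (i # is) g = pd i (iter_pd is g)"

definition smooth_cube :: "(real^'n::finite \<Rightarrow> real) \<Rightarrow> bool" where
  "smooth_cube f \<longleftrightarrow> (\<exists>U. open U \<and> cbox 0 One \<subseteq> U \<and>
     (\<forall>is. continuous_on U (iter_pd is f) \<and>
        (\<forall>i. \<forall>x\<in>U. (\<lambda>t. iter_pd is f (x + t *\<^sub>R axis i 1)) differentiable (at (0::real)))))"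

definition L1norm :: "(real^'n::finite \<Rightarrow> real) \<Rightarrow> real" where
  "L1norm g = (LINT x : cbox 0 One | lborel. \<bar>g x\<bar>)"

definition Jmax :: "'n set set \<Rightarrow> nat" where
  "Jmax \<J> = Max (card ` \<J>)"

definition Tm :: "'n::finite itself \<Rightarrow> real \<Rightarrow> real \<Rightarrow> real \<Rightarrow> nat \<Rightarrow> nat \<Rightarrow> real" where
  "Tm T B K D J m = K * 2 powr (- real (Nm T B m)
      + 2 * real J * log 2 (real m) * sqrt (lambda_c * real (Nm T B m) / real CARD('n))
      + D * real m)"

text \<open>Z(k) for a generating matrix given by its rows 1..N (C (j,l,c) = C_j(l,c)).\<close>
definition Zdes :: "nat \<Rightarrow> ('n::finite \<times> nat \<times> nat \<Rightarrow> bool) \<Rightarrow> nat^'n \<Rightarrow> bool" where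
  "Zdes m C k \<longleftrightarrow> (\<forall>c<m. even (\<Sum>j\<in>UNIV. \<Sum>l\<in>kappa (k $ j). if C (j, l, c) then 1 else (0::nat)))"

definition Omega_C :: "nat \<Rightarrow> nat \<Rightarrow> ('n::finite \<times> nat \<times> nat \<Rightarrow> bool) set" where
  "Omega_C N m = PiE (UNIV \<times> {1..N} \<times> {0..<m}) (\<lambda>_. UNIV)"

definition Omega_S :: "nat \<Rightarrow> (nat^'n::finite \<Rightarrow> real) set" where
  "Omega_S N = PiE (Q N) (\<lambda>_. {-1, 1})"

definition SUM1 :: "(real^'n::finite \<Rightarrow> real) \<Rightarrow> nat \<Rightarrow> nat \<Rightarrow> ('n \<times> nat \<times> nat \<Rightarrow> bool)
    \<Rightarrow> (nat^'n \<Rightarrow> real) \<Rightarrow> real" where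
  "SUM1 f N m C S = (\<Sum>k\<in>Q N. (if Zdes m C k then 1 else 0) * S k * fhat f k)"

text \<open>Pr(|SUM'_{1,m}| <= T) under the complete random design; the event only depends on
  rows 1..N of the C_j (N = N_m) and on S' restricted to Q_N, so uniform measure on these
  finitely many coordinates gives exactly the probability.\<close>
definition prob_small :: "(real^'n::finite \<Rightarrow> real) \<Rightarrow> nat \<Rightarrow> nat \<Rightarrow> real \<Rightarrow> real" where
  "prob_small f N m T = measure_pmf.prob (pmf_of_set (Omega_C N m \<times> Omega_S N))
      {(C, S). \<bar>SUM1 f N m C S\<bar> \<le> T}"

end

theory Submission
  imports Defs
begin

text \<open>
  Let \<open>W = Q\<^bsub>N\<^esub> \<inter> \<Lambda>(T)\<close> with \<open>N = N\<^sub>m\<close>, \<open>T = T\<^sub>m\<close>, let \<open>M\<close> be the number of \<open>k \<in> W\<close> with \<open>Z(k) = 1\<close>, and let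
  \<open>\<mu> = |W| / 2\<^sup>m\<close> be its mean. Expanding \<open>Z(k)\<close> into characters of the group of design matrices,
  distinct \<open>k \<noteq> 0\<close> involve distinct nontrivial characters, so the variance of \<open>M\<close> is at most \<open>\<mu>\<close>,
  and \<open>M \<le> \<mu> / 2\<close> has probability at most \<open>4 / \<mu>\<close> by Chebyshev. Conditionally on the design, the
  sum contains \<open>M\<close> random signs with coefficients of size at least \<open>T\<close>, so by the Littlewood--Offord
  inequality of Erdos it falls into \<open>[-T, T]\<close> with probability at most \<open>2 / \<surd>M\<close>. Finally
  \<open>|Q\<^bsub>N+1\<^esub>|\<close> is at most a constant times \<open>|Q\<^bsub>N\<^esub>|\<close>, whence \<open>|Q\<^bsub>N\<^esub>|\<close> is of order \<open>m 2\<^sup>m\<close> at \<open>N = N\<^sub>m\<close>, so that the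
  density assumption gives \<open>\<mu> \<ge> e m\<close> for some \<open>e > 0\<close> and all large \<open>m\<close>.
\<close>


subsection \<open>Sperner families and the Littlewood--Offord inequality\<close>

text \<open>Apply the induction hypothesis to the members avoiding \<open>x\<close>, for each \<open>x \<in> S\<close>, and sum over \<open>x\<close>.\<close>

lemma lym_inequality:
  fixes \<A> :: "'a set set"
  assumes "finite S" and "\<A> \<subseteq> Pow S"
    and "\<And>F G. F \<in> \<A> \<Longrightarrow> G \<in> \<A> \<Longrightarrow> F \<subseteq> G \<Longrightarrow> F = G"
  shows "(\<Sum>F\<in>\<A>. 1 / real (card S choose card F)) \<le> 1"
  using assms
proof (induction "card S" arbitrary: S \<A>)
  case 0
  then have "S = {}" by simp
  then have "\<A> = {} \<or> \<A> = {{}}" using \<open>\<A> \<subseteq> Pow S\<close> by auto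
  then show ?case by auto
next
  case (Suc n)
  note fin = \<open>finite S\<close> and sub = \<open>\<A> \<subseteq> Pow S\<close> and anti = Suc.prems(3)
  have finA: "finite \<A>" using fin sub by (meson finite_Pow_iff finite_subset)
  show ?case
  proof (cases "S \<in> \<A>")
    case True
    have "F = S" if "F \<in> \<A>" for F using anti[OF that True] that sub by auto
    then have "\<A> = {S}" using True by blast
    then show ?thesis by simp
  next
    case False
    have step: "(\<Sum>F\<in>{F\<in>\<A>. x \<notin> F}. 1 / real (n choose card F)) \<le> 1" if x: "x \<in> S" for x
    proof -
      have c: "n = card (S - {x})" using x fin Suc.hyps(2) by simp
      have "(\<Sum>F\<in>{F\<in>\<A>. x \<notin> F}. 1 / real (card (S - {x}) choose card F)) \<le> 1"
        proof (rule Suc.hyps(1)[OF c])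
        show "finite (S - {x})" using fin by simp
        show "{F \<in> \<A>. x \<notin> F} \<subseteq> Pow (S - {x})" using sub by auto
        show "F = G" if "F \<in> {F \<in> \<A>. x \<notin> F}" "G \<in> {F \<in> \<A>. x \<notin> F}" "F \<subseteq> G" for F G
          using that by (intro anti) auto
      qed
      then show ?thesis using c by simp
    qed
    \<comment> \<open>Double counting of pairs \<open>x \<notin> F\<close>: a member
      \<open>F\<close> misses \<open>Suc n - card F\<close> points, and the absorption identity for
      binomials makes its weight times \<open>Suc n\<close> the sum of its weights in the
      \<open>n\<close>-point sets \<open>S - {x}\<close>.\<close>
    have "real (Suc n) * (\<Sum>F\<in>\<A>. 1 / real (card S choose card F))
        = (\<Sum>F\<in>\<A>. \<Sum>x\<in>S - F. 1 / real (n choose card F))"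
      unfolding sum_distrib_left
    proof (rule sum.cong[OF refl])
      fix F assume F: "F \<in> \<A>"
      then have FS: "F \<subset> S" using sub False by auto
      then have lt: "card F < Suc n" using fin Suc.hyps(2) psubset_card_mono by metis
      have cd: "card (S - F) = Suc n - card F"
        using FS fin Suc.hyps(2) by (metis card_Diff_subset finite_subset psubset_imp_subset)
      have "(Suc n - card F) * (Suc n choose card F) = Suc n * (n choose card F)"
        using binomial_absorb_comp[of "Suc n" "card F"] by simp
      then have "real (Suc n - card F) * real (Suc n choose card F) = real (Suc n) * real (n choose card F)"
        by (metis of_nat_mult)
      moreover have "real (Suc n choose card F) > 0" "real (n choose card F) > 0"
        using lt by (auto simp: zero_less_binomial_iff)
      ultimately show "real (Suc n) * (1 / real (card S choose card F))
          = (\<Sum>x\<in>S - F. 1 / real (n choose card F))"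
        using cd Suc.hyps(2) by (simp add: field_simps del: binomial_Suc_Suc)
    qed
    also have "\<dots> = (\<Sum>x\<in>S. \<Sum>F\<in>{F\<in>\<A>. x \<notin> F}. 1 / real (n choose card F))"
    proof -
      have "(\<Sum>F\<in>\<A>. \<Sum>x\<in>S - F. 1 / real (n choose card F))
          = (\<Sum>F\<in>\<A>. \<Sum>x\<in>{x\<in>S. x \<notin> F}. 1 / real (n choose card F))"
        by (intro sum.cong) auto
      also have "\<dots> = (\<Sum>x\<in>S. \<Sum>F\<in>{F\<in>\<A>. x \<notin> F}. 1 / real (n choose card F))"
        by (rule sum.swap_restrict[OF finA fin])
      finally show ?thesis .
    qed
    also have "\<dots> \<le> (\<Sum>x\<in>S. 1)" by (intro sum_mono step)
    also have "\<dots> = real (Suc n)" using Suc.hyps(2) by simp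
    finally show ?thesis by simp
  qed
qed

text \<open>The middle binomial coefficient is the largest, so every summand of the LYM sum is at
  least its reciprocal.\<close>

lemma sperner:
  fixes \<A> :: "'a set set"
  assumes "finite S" and "\<A> \<subseteq> Pow S"
    and "\<And>F G. F \<in> \<A> \<Longrightarrow> G \<in> \<A> \<Longrightarrow> F \<subseteq> G \<Longrightarrow> F = G"
  shows "card \<A> \<le> card S choose (card S div 2)"
proof -
  let ?c = "real (card S choose (card S div 2))"
  have pos: "?c > 0" by (simp add: zero_less_binomial_iff)
  have "real (card \<A>) * (1 / ?c) = (\<Sum>F\<in>\<A>. 1 / ?c)" by simp
  also have "\<dots> \<le> (\<Sum>F\<in>\<A>. 1 / real (card S choose card F))"
  proof (rule sum_mono)
    fix F assume "F \<in> \<A>"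
    then have "card F \<le> card S" using assms by (auto intro: card_mono)
    then have "real (card S choose card F) > 0" by (simp add: zero_less_binomial_iff)
    then show "1 / ?c \<le> 1 / real (card S choose card F)"
      using binomial_maximum[of "card S" "card F"] by (intro divide_left_mono) auto
  qed
  also have "\<dots> \<le> 1" by (rule lym_inequality[OF assms])
  finally show ?thesis using pos by (simp add: field_simps)
qed

text \<open>Consecutive central coefficients have ratio \<open>2 * (2 * n + 1) / (n + 1)\<close>.
  The factor \<open>2 * n + 1\<close> makes the induction close, because
  \<open>(2 * n + 1) * (2 * n + 3) \<le> 4 * (n + 1)\<^sup>2\<close>.\<close>

lemma central_binomial_square_bound: "((2 * n) choose n)\<^sup>2 * (2 * n + 1) \<le> 16 ^ n"
proof (induction n)
  case (Suc n)
  define a b where "a = (2 * n) choose n" and "b = (2 * Suc n) choose Suc n"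
  have "Suc n * b = 2 * (Suc n * ((2 * n + 1) choose n))"
    unfolding b_def using Suc_times_binomial[of n "2 * n + 1"] by simp
  moreover have "Suc n * ((2 * n + 1) choose n) = Suc (2 * n) * a"
    unfolding a_def using Suc_times_binomial[of n "2 * n"] binomial_symmetric[of n "2 * n + 1"] by simp
  ultimately have eq: "Suc n * b = 2 * (2 * n + 1) * a" by (simp add: mult.assoc)
  have "(Suc n)\<^sup>2 * (b\<^sup>2 * (2 * Suc n + 1)) = (Suc n * b)\<^sup>2 * (2 * n + 3)"
    unfolding power_mult_distrib by (simp add: algebra_simps del: power_Suc)
  also have "\<dots> = (a\<^sup>2 * (2 * n + 1)) * (4 * (2 * n + 1) * (2 * n + 3))"
    unfolding eq by (simp add: power2_eq_square algebra_simps)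
  also have "\<dots> \<le> 16 ^ n * (4 * (2 * n + 1) * (2 * n + 3))"
    by (rule mult_right_mono[OF Suc.IH[folded a_def]]) simp
  also have "\<dots> \<le> 16 ^ n * (16 * (Suc n)\<^sup>2)"
    by (rule mult_left_mono) (simp_all add: power2_eq_square algebra_simps)
  finally have "(Suc n)\<^sup>2 * (b\<^sup>2 * (2 * Suc n + 1)) \<le> (Suc n)\<^sup>2 * 16 ^ Suc n"
    by (simp add: mult_ac)
  then show ?case unfolding b_def[symmetric] by (metis mult_le_cancel1 zero_less_Suc zero_less_power)
qed simp

lemma central_binomial_upper_bound: "real (n choose (n div 2)) * sqrt (real n) \<le> 2 ^ n"
proof -
  have "(n choose (n div 2))\<^sup>2 * n \<le> 4 ^ n"
  proof (cases "even n")
    case True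
    then obtain k where k: "n = 2 * k" by blast
    have "((2 * k) choose k)\<^sup>2 * (2 * k) \<le> ((2 * k) choose k)\<^sup>2 * (2 * k + 1)" by simp
    also have "\<dots> \<le> 16 ^ k" by (rule central_binomial_square_bound)
    also have "\<dots> = 4 ^ (2 * k)" by (simp add: power_mult)
    finally show ?thesis using k by simp
  next
    case False
    then obtain k where k: "n = 2 * k + 1" using oddE by blast
    \<comment> \<open>In an odd row the two middle coefficients agree, so each is half the central
      coefficient of the next row.\<close>
    have "(2 * Suc k) choose Suc k = ((2 * k + 1) choose k) + ((2 * k + 1) choose Suc k)"
      by simp
    then have d: "(2 * Suc k) choose Suc k = 2 * ((2 * k + 1) choose k)"
      using binomial_symmetric[of k "2 * k + 1"] by simp
    have "4 * (((2 * k + 1) choose k)\<^sup>2 * (2 * k + 1)) \<le> ((2 * Suc k) choose Suc k)\<^sup>2 * (2 * Suc k + 1)"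
      unfolding d by (simp add: power_mult_distrib)
    also have "\<dots> \<le> 16 ^ Suc k" by (rule central_binomial_square_bound)
    also have "\<dots> = 4 * 4 ^ (2 * k + 1)" by (simp add: power_mult)
    finally show ?thesis using k by simp
  qed
  then have "real ((n choose (n div 2))\<^sup>2 * n) \<le> real (4 ^ n)" by linarith
  then have "(real (n choose (n div 2)) * sqrt (real n))\<^sup>2 \<le> (2 ^ n)\<^sup>2"
    by (simp add: power_mult_distrib power_even_eq[symmetric] power_mult[symmetric] mult.commute[of n 2])
       (simp add: power_mult)
  then show ?thesis by (rule power2_le_imp_le) simp
qed

text \<open>Enlarging \<open>F\<close> raises the signed sum by at least \<open>2 * T\<close>, so
  the sets whose sums lie in a window shorter than that form an antichain. The closed window has
  length exactly \<open>2 * T\<close>; cutting it at \<open>0\<close> costs the factor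
  \<open>2\<close>.\<close>

lemma card_signed_sums_in_window:
  fixes a :: "'a \<Rightarrow> real"
  assumes fin: "finite V" and a: "\<And>k. k \<in> V \<Longrightarrow> a k \<ge> T" and T: "T > 0"
  shows "card {F \<in> Pow V. \<bar>sum a F - sum a (V - F) + r\<bar> \<le> T} \<le> 2 * (card V choose (card V div 2))"
proof -
  define h where "h F = sum a F - sum a (V - F) + r" for F
  have diff: "h G - h F \<ge> 2 * T" if FG: "F \<subset> G" "G \<subseteq> V" for F G
  proof -
    have finG: "finite G" using FG fin finite_subset by blast
    have finF: "finite F" using FG finG finite_subset by blast
    have h': "h X = 2 * sum a X - sum a V + r" if "X \<subseteq> V" for X
      using sum_diff[OF fin that, of a] by (simp add: h_def)
    obtain x where x: "x \<in> G - F" using FG by blast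
    have "sum a (G - F) \<ge> a x"
    proof (rule member_le_sum[OF x])
      fix y assume "y \<in> G - F - {x}"
      then have "a y \<ge> T" using FG a by blast
      then show "0 \<le> a y" using T by simp
    qed (use finG in simp)
    also have "a x \<ge> T" using x FG a by auto
    finally have "sum a G - sum a F \<ge> T" using sum_diff[of G F a] FG finG finF by auto
    then show ?thesis using h'[of G] h'[of F] FG by auto
  qed
  have sep: "F = G" if "F \<subseteq> G" "G \<subseteq> V" "h G - h F < 2 * T" for F G
    using diff[of F G] that by auto
  let ?A = "{F \<in> Pow V. - T \<le> h F \<and> h F \<le> 0}" and ?B = "{F \<in> Pow V. 0 < h F \<and> h F \<le> T}"
  have "card ?A \<le> card V choose (card V div 2)"
  proof (rule sperner[OF fin])
    show "F = G" if "F \<in> ?A" "G \<in> ?A" "F \<subseteq> G" for F G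
      by (rule sep) (use that T in auto)
  qed auto
  moreover have "card ?B \<le> card V choose (card V div 2)"
  proof (rule sperner[OF fin])
    show "F = G" if "F \<in> ?B" "G \<in> ?B" "F \<subseteq> G" for F G
      by (rule sep) (use that T in auto)
  qed auto
  moreover have "{F \<in> Pow V. \<bar>h F\<bar> \<le> T} = ?A \<union> ?B" using T by auto
  ultimately show ?thesis unfolding h_def[symmetric] using card_Un_le[of ?A ?B] by simp
qed

text \<open>With the signs outside \<open>V\<close> fixed, the signs on \<open>V\<close> are encoded
  by the set where \<open>S k * b k\<close> is positive, which reduces the count to a window of
  signed sums of \<open>\<bar>b k\<bar>\<close>. The product form also covers empty
  \<open>V\<close>.\<close>

lemma littlewood_offord:
  fixes b :: "'a \<Rightarrow> real"
  assumes fin: "finite I" and V: "V \<subseteq> I" and b: "\<And>k. k \<in> V \<Longrightarrow> \<bar>b k\<bar> \<ge> T" and T: "T > 0"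
  shows "real (card {S \<in> PiE I (\<lambda>_. {-1, 1}). \<bar>\<Sum>k\<in>I. S k * b k\<bar> \<le> T}) * sqrt (real (card V))
    \<le> 2 * 2 ^ card I"
proof -
  define P where "P = PiE (I - V) (\<lambda>_. {-1, 1 :: real})"
  define r where "r R = (\<Sum>k\<in>I - V. R k * b k)" for R :: "'a \<Rightarrow> real"
  define Fam where "Fam R = {F \<in> Pow V. \<bar>(\<Sum>k\<in>F. \<bar>b k\<bar>) - (\<Sum>k\<in>V - F. \<bar>b k\<bar>) + r R\<bar> \<le> T}" for R
  define g where "g S = (restrict S (I - V), {k \<in> V. S k * b k > 0})" for S
  let ?E = "{S \<in> PiE I (\<lambda>_. {-1, 1}). \<bar>\<Sum>k\<in>I. S k * b k\<bar> \<le> T}"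
  have finV: "finite V" using fin V finite_subset by blast
  have finP: "finite P" unfolding P_def using fin by (intro finite_PiE) auto
  have finF: "finite (Fam R)" for R unfolding Fam_def using finV by auto
  have b0: "b k \<noteq> 0" if "k \<in> V" for k using b[OF that] T by auto
  \<comment> \<open>On \<open>V\<close> the coefficient \<open>b k\<close> is nonzero, so the sign
    of \<open>S k * b k\<close> determines \<open>S k\<close>.\<close>
  have inj: "inj_on g ?E"
  proof (rule inj_onI)
    fix S S' assume S: "S \<in> ?E" "S' \<in> ?E" and eq: "g S = g S'"
    show "S = S'"
    proof
      fix k
      consider "k \<notin> I" | "k \<in> I - V" | "k \<in> V" by auto
      then show "S k = S' k"
      proof cases
        case 1 then show ?thesis using S by (auto simp: PiE_def extensional_def)
      next
        case 2
        have "restrict S (I - V) k = restrict S' (I - V) k" using eq by (simp add: g_def)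
        then show ?thesis using 2 by simp
      next
        case 3
        then have "(S k * b k > 0) = (S' k * b k > 0)" using eq by (auto simp: g_def)
        moreover have "S k \<in> {-1,1}" "S' k \<in> {-1,1}" using 3 V S by (auto simp: PiE_def Pi_def)
        ultimately show ?thesis using b0[OF 3] by auto
      qed
    qed
  qed
  have img: "g ` ?E \<subseteq> Sigma P Fam"
  proof (rule image_subsetI)
    fix S assume "S \<in> ?E"
    then have S: "S \<in> PiE I (\<lambda>_. {-1, 1::real})" "\<bar>\<Sum>k\<in>I. S k * b k\<bar> \<le> T" by auto
    let ?F = "{k \<in> V. S k * b k > 0}"
    have pm: "S k = -1 \<or> S k = 1" if "k \<in> I" for k using S that by (auto simp: PiE_def Pi_def)
    have "(\<Sum>k\<in>I. S k * b k) = (\<Sum>k\<in>V. S k * b k) + (\<Sum>k\<in>I - V. S k * b k)"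
      using sum.subset_diff[OF V fin] by (simp add: add.commute)
    also have "(\<Sum>k\<in>V. S k * b k) = (\<Sum>k\<in>?F. S k * b k) + (\<Sum>k\<in>V - ?F. S k * b k)"
      using sum.subset_diff[of ?F V, OF _ finV] by (simp add: add.commute)
    also have "(\<Sum>k\<in>?F. S k * b k) = (\<Sum>k\<in>?F. \<bar>b k\<bar>)"
      using pm V by (intro sum.cong) force+
    also have "(\<Sum>k\<in>V - ?F. S k * b k) = (\<Sum>k\<in>V - ?F. - \<bar>b k\<bar>)"
      using pm V by (intro sum.cong) force+
    also have "(\<Sum>k\<in>I - V. S k * b k) = r (restrict S (I - V))"
      unfolding r_def by (intro sum.cong) auto
    finally have "?F \<in> Fam (restrict S (I - V))"
      using S(2) by (simp add: Fam_def sum_negf)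
    moreover have "restrict S (I - V) \<in> P" using pm by (auto simp: P_def)
    ultimately show "g S \<in> Sigma P Fam" by (simp add: g_def)
  qed
  have "card ?E = card (g ` ?E)" using inj by (simp add: card_image)
  also have "\<dots> \<le> card (Sigma P Fam)"
    using img finP finF by (intro card_mono) auto
  also have "\<dots> = (\<Sum>R\<in>P. card (Fam R))" using finP finF by simp
  also have "\<dots> \<le> (\<Sum>R\<in>P. 2 * (card V choose (card V div 2)))"
    unfolding Fam_def by (intro sum_mono card_signed_sums_in_window finV T b)
  also have "\<dots> = 2 ^ (card I - card V) * (2 * (card V choose (card V div 2)))"
    unfolding P_def using fin V finV by (simp add: card_PiE card_Diff_subset numeral_2_eq_2)
  finally have "real (card ?E) \<le> real (2 ^ (card I - card V) * (2 * (card V choose (card V div 2))))"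
    by linarith
  then have "real (card ?E) * sqrt (real (card V))
      \<le> real (2 ^ (card I - card V) * (2 * (card V choose (card V div 2)))) * sqrt (real (card V))"
    by (rule mult_right_mono) simp
  also have "\<dots> = 2 * 2 ^ (card I - card V) * (real (card V choose (card V div 2)) * sqrt (real (card V)))"
    by simp
  also have "\<dots> \<le> 2 * 2 ^ (card I - card V) * 2 ^ card V"
    by (intro mult_left_mono central_binomial_upper_bound) simp
  also have "\<dots> = 2 * 2 ^ card I"
    using card_mono[OF fin V] by (simp add: power_add[symmetric])
  finally show ?thesis .
qed

subsection \<open>Characters of finite Boolean groups\<close>

text \<open>The character indexed by \<open>X\<close> of the group of Boolean functions under
  pointwise exclusive or.\<close>

definition sign_char :: "'a set \<Rightarrow> ('a \<Rightarrow> bool) \<Rightarrow> real" where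
  "sign_char X C = (\<Prod>x\<in>X. if C x then -1 else 1)"

text \<open>The factors over \<open>X \<inter> Y\<close> occur twice and square to
  \<open>1\<close>.\<close>

lemma sign_char_mult:
  assumes "finite X" "finite Y"
  shows "sign_char X C * sign_char Y C = sign_char (sym_diff X Y) C"
proof -
  have sq: "sign_char Z C * sign_char Z C = 1" for Z
    unfolding sign_char_def prod.distrib[symmetric] by (rule prod.neutral) auto
  have dX: "sign_char X C = sign_char (X - Y) C * sign_char (X \<inter> Y) C"
    unfolding sign_char_def using prod.union_disjoint[of "X - Y" "X \<inter> Y"] assms
    by (simp add: Un_Diff_Int disjoint_iff)
  have dY: "sign_char Y C = sign_char (Y - X) C * sign_char (X \<inter> Y) C"
    unfolding sign_char_def Int_commute[of X Y] using prod.union_disjoint[of "Y - X" "Y \<inter> X"] assms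
    by (simp add: Un_Diff_Int disjoint_iff)
  have dD: "sign_char (sym_diff X Y) C = sign_char (X - Y) C * sign_char (Y - X) C"
    unfolding sign_char_def using assms by (intro prod.union_disjoint) auto
  show ?thesis unfolding dX dY dD using sq[of "X \<inter> Y"] by (simp add: algebra_simps)
qed

text \<open>Orthogonality to the trivial character: the sum factors over coordinates, with factor
  \<open>1 - 1 = 0\<close> inside \<open>X\<close> and \<open>2\<close> outside.\<close>

lemma sum_sign_char:
  assumes fin: "finite I" and X: "X \<subseteq> I"
  shows "(\<Sum>C\<in>PiE I (\<lambda>_. UNIV). sign_char X C) = (if X = {} then 2 ^ card I else 0)"
proof -
  have "(\<Sum>C\<in>PiE I (\<lambda>_. UNIV). sign_char X C)
      = (\<Sum>C\<in>PiE I (\<lambda>_. UNIV). \<Prod>x\<in>I. if x \<in> X then (if C x then -1 else 1) else (1::real))"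
    unfolding sign_char_def using fin X
    by (intro sum.cong refl) (simp add: prod.If_cases Int_absorb1)
  also have "\<dots> = (\<Prod>x\<in>I. \<Sum>y\<in>(UNIV::bool set). if x \<in> X then (if y then -1 else 1) else (1::real))"
    by (rule prod_sum_PiE[symmetric]) (use fin in auto)
  also have "\<dots> = (\<Prod>x\<in>I. if x \<in> X then 0 else 2)"
    by (intro prod.cong) (auto simp: UNIV_bool)
  also have "\<dots> = (if X = {} then 2 ^ card I else 0)"
    using fin X by (auto simp: prod_zero_iff)
  finally show ?thesis .
qed

text \<open>Parseval: by injectivity of \<open>g\<close>, the product of two different characters is
  a nontrivial character and sums to zero, so only the diagonal survives.\<close>

lemma sum_square_sign_chars:
  assumes fin: "finite I" and P: "finite P" and inj: "inj_on g P" and g: "\<And>a. a \<in> P \<Longrightarrow> g a \<subseteq> I"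
  shows "(\<Sum>C\<in>PiE I (\<lambda>_. UNIV). (\<Sum>a\<in>P. sign_char (g a) C)\<^sup>2) = 2 ^ card I * real (card P)"
proof -
  have "(\<Sum>C\<in>PiE I (\<lambda>_. UNIV). (\<Sum>a\<in>P. sign_char (g a) C)\<^sup>2)
      = (\<Sum>C\<in>PiE I (\<lambda>_. UNIV). \<Sum>a\<in>P. \<Sum>b\<in>P. sign_char (g a) C * sign_char (g b) C)"
    by (simp add: power2_eq_square sum_product)
  also have "\<dots> = (\<Sum>a\<in>P. \<Sum>C\<in>PiE I (\<lambda>_. UNIV). \<Sum>b\<in>P. sign_char (g a) C * sign_char (g b) C)"
    by (rule sum.swap)
  also have "\<dots> = (\<Sum>a\<in>P. \<Sum>b\<in>P. \<Sum>C\<in>PiE I (\<lambda>_. UNIV). sign_char (g a) C * sign_char (g b) C)"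
    by (intro sum.cong refl sum.swap)
  also have "\<dots> = (\<Sum>a\<in>P. \<Sum>b\<in>P. if a = b then 2 ^ card I else 0)"
  proof (intro sum.cong refl)
    fix a b assume ab: "a \<in> P" "b \<in> P"
    have f: "finite (g a)" "finite (g b)" using g ab fin finite_subset by blast+
    have "(\<Sum>C\<in>PiE I (\<lambda>_. UNIV). sign_char (g a) C * sign_char (g b) C)
        = (\<Sum>C\<in>PiE I (\<lambda>_. UNIV). sign_char (sym_diff (g a) (g b)) C)"
      using f by (simp add: sign_char_mult)
    also have "\<dots> = (if sym_diff (g a) (g b) = {} then 2 ^ card I else 0)"
      by (rule sum_sign_char[OF fin]) (use g[of a] g[of b] ab in blast)
    also have "sym_diff (g a) (g b) = {} \<longleftrightarrow> a = b"
      using inj ab by (auto dest: inj_onD)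
    finally show "(\<Sum>C\<in>PiE I (\<lambda>_. UNIV). sign_char (g a) C * sign_char (g b) C)
        = (if a = b then 2 ^ card I else 0)" .
  qed
  also have "\<dots> = 2 ^ card I * real (card P)" using P by simp
  finally show ?thesis .
qed

subsection \<open>Digit sets and the growth of Q\<close>

text \<open>Digits are numbered from \<open>1\<close> here and from \<open>0\<close> in
  \<open>set_decode\<close>; the link gives finiteness and injectivity of digit sets.\<close>

lemma kappa_eq: "kappa k = Suc ` set_decode k"
proof -
  have "l \<in> Suc ` set_decode k" if "l \<in> kappa k" for l
    using that by (cases l) (auto simp: kappa_def set_decode_def)
  then show ?thesis by (auto simp: kappa_def set_decode_def)
qed

lemma finite_kappa [simp]: "finite (kappa k)"
  by (simp add: kappa_eq)

lemma kappa_inject: "kappa a = kappa b \<longleftrightarrow> a = b"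
proof
  assume "kappa a = kappa b"
  then have "set_decode a = set_decode b" by (simp add: kappa_eq inj_image_eq_iff)
  then have "set_encode (set_decode a) = set_encode (set_decode b)" by (rule arg_cong)
  then show "a = b" by simp
qed simp

text \<open>One set holds the digits of all coordinates, so that \<open>norm1\<close> becomes the
  total weight of a finite set of pairs.\<close>

definition bits :: "nat^'n::finite \<Rightarrow> ('n \<times> nat) set" where
  "bits k = Sigma UNIV (\<lambda>j. kappa (k $ j))"

lemma finite_bits [simp]: "finite (bits k)"
  by (simp add: bits_def)

lemma bits_inject: "bits a = bits b \<longleftrightarrow> a = b"
proof
  assume "bits a = bits b"
  then have "kappa (a $ j) = kappa (b $ j)" for j by (auto simp: bits_def set_eq_iff)
  then show "a = b" by (simp add: kappa_inject vec_eq_iff)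
qed simp

lemma bits_zero [simp]: "bits 0 = {}"
  by (simp add: bits_def kappa_eq)

lemma norm1_eq_sum_bits: "norm1 k = (\<Sum>(j, l)\<in>bits k. l)"
  by (simp add: norm1_def bits_def sum.Sigma)

lemma bits_subset:
  assumes "norm1 k \<le> N"
  shows "bits k \<subseteq> UNIV \<times> {1..N}"
proof clarsimp
  fix j l assume jl: "(j, l) \<in> bits k"
  then have "snd (j, l) \<le> (\<Sum>x\<in>bits k. snd x)" by (intro member_le_sum) auto
  then have "l \<le> N" using assms by (simp add: norm1_eq_sum_bits case_prod_beta)
  moreover have "l \<ge> 1" using jl by (auto simp: bits_def kappa_def)
  ultimately show "Suc 0 \<le> l \<and> l \<le> N" by simp
qed

lemma finite_norm1_le: "finite {k :: nat^'n::finite. norm1 k \<le> N}"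
proof (rule finite_imageD)
  show "finite (bits ` {k :: nat^'n. norm1 k \<le> N})"
    by (rule finite_subset[of _ "Pow (UNIV \<times> {1..N})"]) (use bits_subset in auto)
  show "inj_on bits {k :: nat^'n. norm1 k \<le> N}" by (simp add: inj_on_def bits_inject)
qed

lemma finite_Q [simp]: "finite (Q N)"
  by (rule finite_subset[OF _ finite_norm1_le[of N]]) (auto simp: Q_def)

lemma bits_surj:
  assumes "finite F" "F \<subseteq> UNIV \<times> {1..}"
  obtains k :: "nat^'n::finite" where "bits k = F"
proof
  let ?A = "\<lambda>j. {l. (j, Suc l) \<in> F}"
  have "?A j \<subseteq> (\<lambda>x. snd x - 1) ` F" for j by force
  then have fin: "finite (?A j)" for j using assms(1) finite_subset by blast
  show "bits (\<chi> j. set_encode (?A j)) = F"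
  proof (rule set_eqI, clarify)
    fix j l
    show "(j, l) \<in> bits (\<chi> j. set_encode (?A j)) \<longleftrightarrow> (j, l) \<in> F"
      using assms(2) by (cases l) (auto simp: bits_def kappa_eq fin)
  qed
qed

text \<open>Counting vectors of bounded norm thus becomes counting finite sets of bounded
  weight.\<close>

lemma bits_image_norm1_le:
  "bits ` {k :: nat^'n::finite. norm1 k \<le> N}
    = {F. finite F \<and> F \<subseteq> UNIV \<times> {1..} \<and> (\<Sum>x\<in>F. snd x) \<le> N}" (is "?L = ?R")
proof
  show "?L \<subseteq> ?R"
    by (auto simp: norm1_eq_sum_bits case_prod_beta) (auto simp: bits_def kappa_def)
  show "?R \<subseteq> ?L"
  proof
    fix F :: "('n \<times> nat) set" assume F: "F \<in> ?R"
    then obtain k :: "nat^'n" where "bits k = F" using bits_surj by blast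
    then show "F \<in> ?L" using F by (auto simp: norm1_eq_sum_bits case_prod_beta)
  qed
qed

text \<open>The extra \<open>1\<close> is the zero vector, which \<open>Q\<close> excludes.\<close>

lemma card_bits_image: "card (bits ` {k :: nat^'n::finite. norm1 k \<le> N}) = card (Q N :: (nat^'n) set) + 1"
proof -
  have "{k :: nat^'n. norm1 k \<le> N} = insert 0 (Q N)"
    by (auto simp: Q_def norm1_eq_sum_bits)
  moreover have "(0 :: nat^'n) \<notin> Q N" by (simp add: Q_def)
  ultimately have "card {k :: nat^'n. norm1 k \<le> N} = card (Q N :: (nat^'n) set) + 1" by simp
  moreover have "inj_on bits {k :: nat^'n. norm1 k \<le> N}" by (simp add: inj_on_def bits_inject)
  ultimately show ?thesis by (simp add: card_image)
qed

text \<open>The singletons \<open>{(j, l)}\<close> with one fixed \<open>j\<close> suffice. This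
  crude growth makes the supremum defining \<open>Nm\<close> a maximum.\<close>

lemma card_Q_ge: "N \<le> card (Q N :: (nat^'n::finite) set) + 1"
proof -
  obtain j :: 'n where True by simp
  have "(\<lambda>l. {(j, l)}) ` {1..N} \<subseteq> bits ` {k :: nat^'n. norm1 k \<le> N}"
    unfolding bits_image_norm1_le by auto
  then have "card ((\<lambda>l. {(j, l)}) ` {1..N}) \<le> card (bits ` {k :: nat^'n. norm1 k \<le> N})"
    by (intro card_mono finite_imageI finite_norm1_le)
  moreover have "card ((\<lambda>l. {(j, l)}) ` {1..N}) = N"
    by (subst card_image) (auto simp: inj_on_def)
  ultimately show ?thesis by (simp add: card_bits_image)
qed

text \<open>A bit set of weight \<open>N + 1\<close> arises from one of weight \<open>N\<close> either by adding bit \<open>1\<close> or by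
  raising the lowest bit, in one of the coordinates.\<close>

lemma card_Q_Suc_le:
  "card (Q (Suc N) :: (nat^'n::finite) set) + 1
    \<le> (2 * CARD('n) + 1) * (card (Q N :: (nat^'n) set) + 1)"
proof -
  define \<B> where "\<B> N = {F :: ('n \<times> nat) set. finite F \<and> F \<subseteq> UNIV \<times> {1..} \<and> (\<Sum>x\<in>F. snd x) \<le> N}" for N
  define raise where "raise j F = (let l = Min {l. (j, l) \<in> F} in insert (j, Suc l) (F - {(j, l)}))"
    for j and F :: "('n \<times> nat) set"
  have card\<B>: "card (\<B> N) = card (Q N :: (nat^'n) set) + 1" for N
    unfolding \<B>_def by (simp only: card_bits_image[symmetric] bits_image_norm1_le)
  have fin\<B>: "finite (\<B> N)" for N
    unfolding \<B>_def bits_image_norm1_le[symmetric] by (intro finite_imageI finite_norm1_le)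
  have cover: "\<B> (Suc N) \<subseteq> \<B> N \<union> (\<Union>j. insert (j, 1) ` \<B> N \<union> raise j ` \<B> N)"
  proof
    fix F assume "F \<in> \<B> (Suc N)"
    then have F: "finite F" "F \<subseteq> UNIV \<times> {1..}" "(\<Sum>x\<in>F. snd x) \<le> Suc N" by (auto simp: \<B>_def)
    show "F \<in> \<B> N \<union> (\<Union>j. insert (j, 1) ` \<B> N \<union> raise j ` \<B> N)"
    proof (cases "(\<Sum>x\<in>F. snd x) \<le> N")
      case True
      then show ?thesis using F by (auto simp: \<B>_def)
    next
      case False
      then have "F \<noteq> {}" by auto
      then obtain j l0 where "(j, l0) \<in> F" by fastforce
      define L where "L = {l. (j, l) \<in> F}"
      have "L \<subseteq> snd ` F" by (force simp: L_def)
      then have finL: "finite L" using F(1) finite_subset by blast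
      have neL: "L \<noteq> {}" using \<open>(j, l0) \<in> F\<close> by (auto simp: L_def)
      define l where "l = Min L"
      have lF: "(j, l) \<in> F" using Min_in[OF finL neL] by (simp add: l_def L_def)
      then have l1: "l \<ge> 1" using F(2) by auto
      have low: "l \<le> l'" if "(j, l') \<in> F" for l' using that finL by (simp add: l_def L_def)
      have sumF: "(\<Sum>x\<in>F. snd x) = l + (\<Sum>x\<in>F - {(j, l)}. snd x)"
        using sum.remove[OF F(1) lF, of snd] by simp
      show ?thesis
      \<comment> \<open>A lowest bit at \<open>1\<close> is removed; otherwise it moves down to
        \<open>l - 1\<close>, which is free by minimality of \<open>l\<close>. Either way the weight
        drops by one.\<close>
      proof (cases "l = 1")
        case True
        then have "F - {(j, 1)} \<in> \<B> N" using F sumF by (auto simp: \<B>_def)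
        moreover have "F = insert (j, 1) (F - {(j, 1)})" using lF True by auto
        ultimately show ?thesis by blast
      next
        case False
        define F' where "F' = insert (j, l - 1) (F - {(j, l)})"
        have nin: "(j, l - 1) \<notin> F" using low[of "l - 1"] l1 by auto
        have "(\<Sum>x\<in>F'. snd x) = (l - 1) + (\<Sum>x\<in>F - {(j, l)}. snd x)"
          unfolding F'_def using nin F(1) by (subst sum.insert) auto
        then have F': "F' \<in> \<B> N" using F sumF l1 False unfolding \<B>_def F'_def by auto
        \<comment> \<open>The lowered bit is still the lowest in its coordinate, so
          \<open>raise j\<close> moves exactly this bit back.\<close>
        have "Min {l'. (j, l') \<in> F'} = l - 1"
        proof (rule Min_eqI)
          have "{l'. (j, l') \<in> F'} \<subseteq> insert (l - 1) L" by (auto simp: F'_def L_def)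
          then show "finite {l'. (j, l') \<in> F'}" using finL finite_subset by blast
          show "l - 1 \<le> y" if "y \<in> {l'. (j, l') \<in> F'}" for y
            using that low[of y] by (auto simp: F'_def)
          show "l - 1 \<in> {l'. (j, l') \<in> F'}" by (simp add: F'_def)
        qed
        then have "raise j F' = insert (j, l) (F' - {(j, l - 1)})"
          using l1 by (simp add: raise_def)
        also have "\<dots> = F" using nin lF by (auto simp: F'_def)
        finally show ?thesis using F' by blast
      qed
    qed
  qed
  have "card (\<B> (Suc N)) \<le> card (\<B> N \<union> (\<Union>j. insert (j, 1) ` \<B> N \<union> raise j ` \<B> N))"
    using cover fin\<B> by (intro card_mono) auto
  also have "\<dots> \<le> card (\<B> N) + card (\<Union>j. insert (j, 1) ` \<B> N \<union> raise j ` \<B> N)"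
    by (rule card_Un_le)
  also have "card (\<Union>j. insert (j, 1) ` \<B> N \<union> raise j ` \<B> N)
      \<le> (\<Sum>j\<in>(UNIV :: 'n set). card (insert (j, 1) ` \<B> N \<union> raise j ` \<B> N))"
    by (rule card_UN_le) simp
  also have "\<dots> \<le> (\<Sum>j\<in>(UNIV :: 'n set). card (\<B> N) + card (\<B> N))"
    by (intro sum_mono order_trans[OF card_Un_le] add_mono card_image_le fin\<B>)
  finally have "card (\<B> (Suc N)) \<le> (2 * CARD('n) + 1) * card (\<B> N)" by (simp add: algebra_simps)
  then show ?thesis by (simp only: card\<B>)
qed

text \<open>By maximality \<open>Nm + 1\<close> violates the inequality defining \<open>Nm\<close>,
  and passing from \<open>Q (Nm + 1)\<close> back to \<open>Q Nm\<close> costs at most the factor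
  \<open>2 * CARD('n) + 1\<close>.\<close>

lemma card_Q_Nm_ge:
  assumes "B > 0"
  shows "real (card (Q (Nm TYPE('n::finite) B m) :: (nat^'n) set)) + 1
    \<ge> c_s TYPE('n) B / (2 * real CARD('n) + 1) * real m * 2 ^ m"
proof -
  let ?R = "c_s TYPE('n) B * real m * 2 ^ m"
  let ?X = "{N. real (card (Q N :: (nat^'n) set)) \<le> ?R}"
  have "0 < c_s TYPE('n) B" using assms by (simp add: c_s_def lambda_c_def)
  then have R0: "0 \<le> ?R" by simp
  have "N \<le> nat \<lceil>?R + 1\<rceil>" if "N \<in> ?X" for N
  proof -
    have "real N \<le> real (card (Q N :: (nat^'n) set) + 1)" using card_Q_ge of_nat_le_iff by blast
    then show ?thesis using that by simp linarith
  qed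
  then have "?X \<subseteq> {..nat \<lceil>?R + 1\<rceil>}" by blast
  then have finX: "finite ?X" using finite_subset by blast
  \<comment> \<open>Being bounded and nonempty, \<open>?X\<close> has its maximum as
    supremum.\<close>
  have "(0 :: nat) \<in> ?X"
  proof -
    have "k = 0" if "norm1 k \<le> 0" for k :: "nat^'n"
      using bits_subset[OF that] bits_inject[of k 0] by simp
    then have "(Q 0 :: (nat^'n) set) = {}" by (auto simp: Q_def)
    then show ?thesis using R0 by simp
  qed
  then have Nm: "Nm TYPE('n) B m = Max ?X" by (auto simp: Nm_def Sup_nat_def)
  have "Suc (Nm TYPE('n) B m) \<notin> ?X"
    unfolding Nm using Max_ge[OF finX] by (metis Suc_n_not_le_n)
  then have "?R < real (card (Q (Suc (Nm TYPE('n) B m)) :: (nat^'n) set))" by simp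
  also have "\<dots> \<le> real ((2 * CARD('n) + 1) * (card (Q (Nm TYPE('n) B m) :: (nat^'n) set) + 1))"
    using card_Q_Suc_le[of "Nm TYPE('n) B m", where 'n='n] of_nat_le_iff
    by (smt (verit) of_nat_1 of_nat_add)
  finally show ?thesis by (simp add: field_simps)
qed

subsection \<open>Second moment of the number of vanishing frequencies\<close>

text \<open>The matrix entries in the rows selected by \<open>k\<close> and the columns in
  \<open>U\<close>; these sets index the characters in the expansion of \<open>Zdes\<close>.\<close>

definition flat_bits :: "nat^'n::finite \<Rightarrow> nat set \<Rightarrow> ('n \<times> nat \<times> nat) set" where
  "flat_bits k U = {(j, l, c). (j, l) \<in> bits k \<and> c \<in> U}"

lemma flat_bits_eq_image: "flat_bits k U = (\<lambda>((j, l), c). (j, l, c)) ` (bits k \<times> U)"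
  by (force simp: flat_bits_def)

text \<open>A product of two nonempty sets determines both factors.\<close>

lemma flat_bits_inject:
  assumes "flat_bits k U = flat_bits k' U'" "k \<noteq> 0" "U \<noteq> {}"
  shows "k = k' \<and> U = U'"
proof -
  have "bits k \<times> U = bits k' \<times> U'"
    using assms(1) by (auto simp: flat_bits_def set_eq_iff)
  moreover have "bits k \<noteq> {}" using assms(2) bits_inject[of k 0] by simp
  ultimately show ?thesis using assms(3) by (metis bits_inject times_eq_iff)
qed

text \<open>The indicator is the product over columns \<open>c\<close> of
  \<open>(1 + ch c) / 2\<close>, where \<open>ch c\<close> is the sign of the parity in column
  \<open>c\<close>. Expanding the product over sets \<open>U\<close> of columns gives the
  characters.\<close>

lemma Zdes_eq_sum_sign_char:
  "(if Zdes m C k then 1 else 0) = (\<Sum>U\<in>Pow {..<m}. sign_char (flat_bits k U) C) / 2 ^ m"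
proof -
  define ch where "ch c = (\<Prod>(j, l)\<in>bits k. if C (j, l, c) then -1 else (1::real))" for c
  define e where "e c = (\<Sum>j\<in>UNIV. \<Sum>l\<in>kappa (k $ j). if C (j, l, c) then 1 else (0::nat))" for c
  have chi: "ch c = (-1) ^ e c" for c
    unfolding ch_def e_def bits_def power_sum
    by (simp add: prod.Sigma[symmetric]) (intro prod.cong refl, simp)
  have half: "(ch c + 1) / 2 = (if even (e c) then 1 else 0)" for c
    by (simp add: chi)
  have "(\<Sum>U\<in>Pow {..<m}. sign_char (flat_bits k U) C) = (\<Sum>U\<in>Pow {..<m}. \<Prod>c\<in>U. ch c)"
  proof (rule sum.cong[OF refl])
    fix U assume "U \<in> Pow {..<m}"
    then have "finite U" using finite_subset by auto
    have "sign_char (flat_bits k U) C = (\<Prod>(x, c)\<in>bits k \<times> U. if C (fst x, snd x, c) then -1 else 1)"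
      unfolding sign_char_def flat_bits_eq_image
      by (subst prod.reindex) (auto simp: inj_on_def case_prod_beta)
    also have "\<dots> = (\<Prod>x\<in>bits k. \<Prod>c\<in>U. if C (fst x, snd x, c) then -1 else 1)"
      by (simp add: prod.cartesian_product)
    also have "\<dots> = (\<Prod>c\<in>U. ch c)"
      unfolding ch_def by (subst prod.swap) (simp add: case_prod_beta)
    finally show "sign_char (flat_bits k U) C = (\<Prod>c\<in>U. ch c)" .
  qed
  also have "\<dots> = (\<Prod>c<m. ch c + 1)" by (subst prod_add) auto
  finally have "(\<Sum>U\<in>Pow {..<m}. sign_char (flat_bits k U) C) / 2 ^ m = (\<Prod>c<m. (ch c + 1) / 2)"
    by (simp add: prod_dividef)
  also have "\<dots> = (if \<forall>c<m. even (e c) then 1 else 0)"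
    unfolding half by (auto simp: prod_zero_iff)
  finally show ?thesis by (simp add: Zdes_def e_def)
qed

text \<open>The terms with \<open>U = {}\<close> add up to the mean; the remaining
  \<open>card W * (2 ^ m - 1)\<close> characters are pairwise distinct, so Parseval applies. Both
  sides are left unnormalised by the number of designs.\<close>

lemma Omega_C_variance:
  fixes W :: "(nat^'n::finite) set" and m :: nat
  assumes W: "W \<subseteq> Q N"
  defines "\<mu> \<equiv> real (card W) / 2 ^ m"
  shows "(\<Sum>C\<in>Omega_C N m. (real (card {k\<in>W. Zdes m C k}) - \<mu>)\<^sup>2)
    \<le> real (card (Omega_C N m :: ('n \<times> nat \<times> nat \<Rightarrow> bool) set)) * \<mu>"
proof -
  define I where "I = (UNIV :: 'n set) \<times> {1..N} \<times> {0..<m}"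
  define P where "P = W \<times> (Pow {..<m} - {{}})"
  have finW: "finite W" using W finite_subset finite_Q by blast
  have finI: "finite I" by (simp add: I_def)
  have Om: "Omega_C N m = PiE I (\<lambda>_. UNIV)" by (simp add: Omega_C_def I_def)
  have cOm: "card (Omega_C N m :: ('n \<times> nat \<times> nat \<Rightarrow> bool) set) = 2 ^ card I"
    unfolding Om using finI by (simp add: card_PiE)
  have dev: "real (card {k\<in>W. Zdes m C k}) - \<mu>
      = (\<Sum>(k, U)\<in>P. sign_char (flat_bits k U) C) / 2 ^ m" for C
  proof -
    have split: "(\<Sum>U\<in>Pow {..<m}. sign_char (flat_bits k U) C)
        = 1 + (\<Sum>U\<in>Pow {..<m} - {{}}. sign_char (flat_bits k U) C)" for k
      by (subst sum.remove[of _ "{}"]) (auto simp: sign_char_def flat_bits_eq_image)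
    have "real (card {k\<in>W. Zdes m C k}) = (\<Sum>k\<in>W. if Zdes m C k then 1 else 0)"
      using finW by (simp add: sum.If_cases Int_def)
    also have "\<dots> = (\<Sum>k\<in>W. 1 + (\<Sum>U\<in>Pow {..<m} - {{}}. sign_char (flat_bits k U) C)) / 2 ^ m"
      unfolding Zdes_eq_sum_sign_char split sum_divide_distrib ..
    also have "\<dots> = \<mu> + (\<Sum>(k, U)\<in>P. sign_char (flat_bits k U) C) / 2 ^ m"
      unfolding P_def \<mu>_def by (simp add: sum.distrib add_divide_distrib sum.cartesian_product)
    finally show ?thesis by simp
  qed
  have inj: "inj_on (\<lambda>(k, U). flat_bits k U) P"
  proof (rule inj_onI, clarify)
    fix k U k' U' assume "(k, U) \<in> P" "(k', U') \<in> P" "flat_bits k U = flat_bits k' U'"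
    moreover then have "k \<noteq> 0" "U \<noteq> {}" using W by (auto simp: P_def Q_def)
    ultimately show "k = k' \<and> U = U'" using flat_bits_inject by blast
  qed
  have sub: "(\<lambda>(k, U). flat_bits k U) a \<subseteq> I" if "a \<in> P" for a
  proof -
    obtain k U where a: "a = (k, U)" by fastforce
    have "bits k \<subseteq> UNIV \<times> {1..N}" using that W a by (intro bits_subset) (auto simp: P_def Q_def)
    then show ?thesis using that a by (auto simp: P_def I_def flat_bits_def)
  qed
  have "(\<Sum>C\<in>Omega_C N m. (real (card {k\<in>W. Zdes m C k}) - \<mu>)\<^sup>2)
      = (\<Sum>C\<in>PiE I (\<lambda>_. UNIV). (\<Sum>a\<in>P. sign_char ((\<lambda>(k, U). flat_bits k U) a) C)\<^sup>2) / (2 ^ m)\<^sup>2"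
    unfolding dev Om by (simp add: power_divide case_prod_beta flip: sum_divide_distrib)
  also have "\<dots> = 2 ^ card I * real (card P) / (2 ^ m)\<^sup>2"
    by (subst sum_square_sign_chars[OF finI _ inj sub]) (auto simp: P_def finW)
  also have "\<dots> \<le> 2 ^ card I * (real (card W) * 2 ^ m) / (2 ^ m)\<^sup>2"
  proof -
    have "card (Pow {..<m} - {{}}) \<le> 2 ^ m"
      using card_mono[of "Pow {..<m}" "Pow {..<m} - {{}}"] by (simp add: card_Pow)
    then have "card P \<le> card W * 2 ^ m" by (simp add: P_def card_cartesian_product)
    then have "real (card P) \<le> real (card W * 2 ^ m)" by linarith
    then show ?thesis by (intro divide_right_mono mult_left_mono) auto
  qed
  also have "\<dots> = 2 ^ card I * \<mu>" by (simp add: \<mu>_def power2_eq_square)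
  finally show ?thesis by (simp add: cOm)
qed

text \<open>Chebyshev: each counted design contributes at least \<open>(\<mu> / 2)\<^sup>2\<close>
  to the second moment, and one factor \<open>\<mu>\<close> cancels.\<close>

lemma Omega_C_few_zeros:
  fixes W :: "(nat^'n::finite) set" and m :: nat
  assumes W: "W \<subseteq> Q N"
  defines "\<mu> \<equiv> real (card W) / 2 ^ m"
  shows "real (card {C\<in>Omega_C N m. real (card {k\<in>W. Zdes m C k}) \<le> \<mu> / 2}) * \<mu>
    \<le> 4 * real (card (Omega_C N m :: ('n \<times> nat \<times> nat \<Rightarrow> bool) set))"
proof (cases "\<mu> = 0")
  case False
  then have pos: "\<mu> > 0" by (simp add: \<mu>_def)
  let ?M = "\<lambda>C. real (card {k\<in>W. Zdes m C k})"
  let ?E = "{C\<in>Omega_C N m. ?M C \<le> \<mu> / 2}"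
  have fin: "finite (Omega_C N m :: ('n \<times> nat \<times> nat \<Rightarrow> bool) set)"
    unfolding Omega_C_def by (intro finite_PiE) auto
  have "real (card ?E) * (\<mu> / 2)\<^sup>2 = (\<Sum>C\<in>?E. (\<mu> / 2)\<^sup>2)" by simp
  also have "\<dots> \<le> (\<Sum>C\<in>?E. (?M C - \<mu>)\<^sup>2)"
  proof (rule sum_mono)
    fix C assume "C \<in> ?E"
    then have "\<mu> / 2 \<le> \<mu> - ?M C" by simp
    then have "(\<mu> / 2)\<^sup>2 \<le> (\<mu> - ?M C)\<^sup>2" using pos by (intro power_mono) auto
    then show "(\<mu> / 2)\<^sup>2 \<le> (?M C - \<mu>)\<^sup>2" by (simp add: power2_commute)
  qed
  also have "\<dots> \<le> (\<Sum>C\<in>Omega_C N m. (?M C - \<mu>)\<^sup>2)"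
    using fin by (intro sum_mono2) auto
  also have "\<dots> \<le> real (card (Omega_C N m :: ('n \<times> nat \<times> nat \<Rightarrow> bool) set)) * \<mu>"
    unfolding \<mu>_def by (rule Omega_C_variance[OF W])
  finally have "(real (card ?E) * \<mu>) * \<mu>
      \<le> (4 * real (card (Omega_C N m :: ('n \<times> nat \<times> nat \<Rightarrow> bool) set))) * \<mu>"
    by (simp add: power2_eq_square field_simps)
  then show ?thesis using pos by (simp only: mult_le_cancel_right)
qed simp

subsection \<open>Small ball probabilities\<close>

text \<open>Designs with at most half the expected number of zeros are rare and get the trivial
  bound \<open>1\<close>; for the others the random signs alone give
  \<open>2 / sqrt (\<mu> / 2)\<close>.\<close>

lemma prob_small_le:
  fixes f :: "real^'n::finite \<Rightarrow> real" and m :: nat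
  assumes W: "W \<subseteq> Q N" and T: "T > 0" and fW: "\<And>k. k \<in> W \<Longrightarrow> \<bar>fhat f k\<bar> \<ge> T"
  defines "\<mu> \<equiv> real (card W) / 2 ^ m"
  assumes mu: "\<mu> > 0"
  shows "prob_small f N m T \<le> 2 / sqrt (\<mu> / 2) + 4 / \<mu>"
proof -
  let ?OC = "Omega_C N m :: ('n \<times> nat \<times> nat \<Rightarrow> bool) set"
  let ?OS = "Omega_S N :: (nat^'n \<Rightarrow> real) set"
  let ?M = "\<lambda>C. real (card {k\<in>W. Zdes m C k})"
  let ?few = "{C\<in>?OC. ?M C \<le> \<mu> / 2}"
  define E where "E C = {S\<in>?OS. \<bar>SUM1 f N m C S\<bar> \<le> T}" for C
  have finC: "finite ?OC" unfolding Omega_C_def by (intro finite_PiE) auto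
  have finS: "finite ?OS" unfolding Omega_S_def by (intro finite_PiE) auto
  have cS: "real (card ?OS) = 2 ^ card (Q N :: (nat^'n) set)"
    by (simp add: Omega_S_def card_PiE numeral_2_eq_2)
  have neC: "?OC \<noteq> {}" by (simp add: Omega_C_def PiE_eq_empty_iff)
  have neS: "?OS \<noteq> {}" by (simp add: Omega_S_def PiE_eq_empty_iff)
  have pC: "real (card ?OC) > 0" and pS: "real (card ?OS) > 0"
    using finC finS neC neS by (simp_all add: card_gt_0_iff)
  have E_le: "real (card (E C)) \<le> real (card ?OS) * (2 / sqrt (\<mu> / 2) + of_bool (C \<in> ?few))"
    if C: "C \<in> ?OC" for C
  proof (cases "C \<in> ?few")
    case True
    have "card (E C) \<le> card ?OS" unfolding E_def by (rule card_mono[OF finS]) auto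
    then have "real (card (E C)) \<le> real (card ?OS) * 1" by simp
    also have "\<dots> \<le> real (card ?OS) * (2 / sqrt (\<mu> / 2) + of_bool (C \<in> ?few))"
      using True mu by (intro mult_left_mono) auto
    finally show ?thesis .
  next
    case False
    \<comment> \<open>On \<open>?V\<close> the coefficient \<open>?b k\<close> equals
      \<open>fhat f k\<close>, hence has size at least \<open>T\<close>; the signs of all other
      frequencies are conditioned on.\<close>
    let ?V = "{k\<in>W. Zdes m C k}"
    let ?b = "\<lambda>k. (if Zdes m C k then 1 else 0) * fhat f k"
    have "E C = {S \<in> PiE (Q N) (\<lambda>_. {-1, 1}). \<bar>\<Sum>k\<in>Q N. S k * ?b k\<bar> \<le> T}"
      unfolding E_def Omega_S_def SUM1_def by (simp add: mult_ac)
    moreover have "real (card {S \<in> PiE (Q N) (\<lambda>_. {-1, 1}). \<bar>\<Sum>k\<in>Q N. S k * ?b k\<bar> \<le> T}) * sqrt (?M C)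
        \<le> 2 * 2 ^ card (Q N :: (nat^'n) set)"
      by (rule littlewood_offord) (use W T fW in auto)
    ultimately have "real (card (E C)) * sqrt (?M C) \<le> 2 * real (card ?OS)" by (simp add: cS)
    moreover have "real (card (E C)) * sqrt (\<mu> / 2) \<le> real (card (E C)) * sqrt (?M C)"
      using False C by (intro mult_left_mono) auto
    ultimately have "real (card (E C)) * sqrt (\<mu> / 2) \<le> 2 * real (card ?OS)" by linarith
    then have "real (card (E C)) \<le> 2 * real (card ?OS) / sqrt (\<mu> / 2)"
      using mu by (subst pos_le_divide_eq) auto
    then show ?thesis using False by (simp only: of_bool_eq) (simp add: mult.commute)
  qed
  have "(?OC \<times> ?OS) \<inter> {(C, S). \<bar>SUM1 f N m C S\<bar> \<le> T} = Sigma ?OC E"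
    by (auto simp: E_def)
  then have "prob_small f N m T = real (card (Sigma ?OC E)) / real (card (?OC \<times> ?OS))"
    unfolding prob_small_def using finC finS neC neS by (subst measure_pmf_of_set) auto
  also have "real (card (Sigma ?OC E)) = (\<Sum>C\<in>?OC. real (card (E C)))"
    using finC finS by (subst card_SigmaI) (auto simp: E_def)
  also have "(\<Sum>C\<in>?OC. real (card (E C)))
      \<le> (\<Sum>C\<in>?OC. real (card ?OS) * (2 / sqrt (\<mu> / 2) + of_bool (C \<in> ?few)))"
    by (rule sum_mono[OF E_le])
  also have "\<dots> = real (card ?OS) * (real (card ?OC) * (2 / sqrt (\<mu> / 2)) + real (card ?few))"
  proof -
    have "(\<Sum>C\<in>?OC. of_bool (C \<in> ?few)) = real (card ?few)"
      using finC by (simp add: Int_def)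
    then show ?thesis by (simp only: sum_distrib_left[symmetric] sum.distrib sum_constant)
  qed
  also have "\<dots> \<le> real (card ?OS) * (real (card ?OC) * (2 / sqrt (\<mu> / 2)) + real (card ?OC) * (4 / \<mu>))"
  proof -
    have "real (card ?few) * \<mu> \<le> 4 * real (card ?OC)"
      unfolding \<mu>_def by (rule Omega_C_few_zeros[OF W])
    then have "real (card ?few) \<le> real (card ?OC) * (4 / \<mu>)"
      using mu by (simp add: field_simps)
    then show ?thesis by (intro mult_left_mono add_left_mono) auto
  qed
  also have "\<dots> = (2 / sqrt (\<mu> / 2) + 4 / \<mu>) * real (card (?OC \<times> ?OS))"
    by (simp add: card_cartesian_product algebra_simps)
  finally show ?thesis using pC pS by (simp add: divide_right_mono card_cartesian_product)
qed

section \<open>Asymptotics along \<open>Nm\<close> as \<open>m\<close> grows\<close>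

theorem theorem5:
  fixes A B \<alpha> K D :: real
    and f :: "real^'n::finite \<Rightarrow> real"
    and \<J> :: "'n set set"
  assumes A_pos: "A > 0" and B_pos: "B > 0"
    and AB: "\<forall>N r. N \<ge> 1 \<longrightarrow> r \<ge> 2 \<longrightarrow>
        measure_pmf.prob (pmf_of_set (PiE {0..<r} (\<lambda>_. (Q N :: (nat^'n) set))))
          {ks. xor_sum r ks \<in> Q N}
        \<le> A ^ r * real N powr (real r / 4) * real r powr (- B * sqrt (real N))"
    and alpha_pos: "\<alpha> > 0" and K_pos: "K > 0"
    and smooth: "smooth_cube f"
    and J_fin: "finite \<J>" and J_ne: "\<J> \<noteq> {}"
    and deriv_bound: "\<forall>(k :: nat^'n) L. (\<forall>i. count (mset L) i = card (kappa (k $ i))) \<longrightarrow>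
        L1norm (iter_pd L f) \<le> K * \<alpha> ^ norm0 k * Max ((\<lambda>J. \<Prod>j\<in>J. fact (card (kappa (k $ j)))) ` \<J>)"
    and dense: "liminf (\<lambda>m. ereal (real (card (Q (Nm TYPE('n) B m) \<inter> Lambda f (Tm TYPE('n) B K D (Jmax \<J>) m)))
                          / real (card (Q (Nm TYPE('n) B m) :: (nat^'n) set)))) > 0"
  shows "limsup (\<lambda>m. ereal (sqrt (real m) *
            prob_small f (Nm TYPE('n) B m) m (Tm TYPE('n) B K D (Jmax \<J>) m))) < \<infinity>"
proof -
  let ?N = "Nm TYPE('n) B"
  let ?T = "Tm TYPE('n) B K D (Jmax \<J>)"
  let ?Q = "\<lambda>m. Q (?N m) :: (nat^'n) set"
  let ?W = "\<lambda>m. ?Q m \<inter> Lambda f (?T m)"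
  obtain \<delta> where \<delta>: "ereal \<delta> > 0"
      "ereal \<delta> < liminf (\<lambda>m. ereal (real (card (?W m)) / real (card (?Q m))))"
    using ereal_dense2[OF dense] by blast
  then have \<delta>0: "\<delta> > 0" by simp
  have ev: "eventually (\<lambda>m. real (card (?W m)) / real (card (?Q m)) > \<delta>) sequentially"
    using less_LiminfD[OF \<delta>(2)] by simp
  define c where "c = c_s TYPE('n) B / (2 * real CARD('n) + 1)"
  have "0 < c_s TYPE('n) B" using B_pos by (simp add: c_s_def lambda_c_def)
  then have c0: "c > 0" by (simp add: c_def)
  \<comment> \<open>The density gives the factor \<open>\<delta>\<close>, the size of
    \<open>Q\<close> at \<open>Nm\<close> the factor \<open>c\<close>, and the \<open>2\<close> pays
    for the added \<open>1\<close> in \<open>card_Q_Nm_ge\<close>; the mean will be at least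
    \<open>e * m\<close>.\<close>
  define e where "e = \<delta> * c / 2"
  have e0: "e > 0" using \<delta>0 c0 by (simp add: e_def)
  have bound: "sqrt (real m) * prob_small f (?N m) m (?T m) \<le> 2 / sqrt (e / 2) + 4 / e"
    if rat: "real (card (?W m)) / real (card (?Q m)) > \<delta>" and m: "m \<ge> max 1 (nat \<lceil>2 / c\<rceil>)" for m
  proof -
    define \<mu> where "\<mu> = real (card (?W m)) / 2 ^ m"
    have m1: "m \<ge> 1" using m by simp
    \<comment> \<open>This threshold makes \<open>c * m * 2 ^ m\<close> at least \<open>2\<close>,
      so subtracting \<open>1\<close> leaves at least half of it.\<close>
    have "real m \<ge> 2 / c" using m by linarith
    then have "c * real m \<ge> 2" using c0 by (simp add: field_simps)
    then have "c * real m * 2 ^ m \<ge> 2 * 1" by (intro mult_mono) auto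
    moreover have "real (card (?Q m)) + 1 \<ge> c * real m * 2 ^ m"
      unfolding c_def by (rule card_Q_Nm_ge[OF B_pos])
    ultimately have Qge: "real (card (?Q m)) \<ge> c / 2 * real m * 2 ^ m" by simp
    \<comment> \<open>Division by zero yields \<open>0\<close>, so a ratio above
      \<open>\<delta>\<close> excludes an empty \<open>?Q m\<close>.\<close>
    have "card (?Q m) \<noteq> 0" using rat \<delta>0 by (intro notI) simp
    then have "real (card (?Q m)) > 0" by linarith
    then have "real (card (?W m)) \<ge> \<delta> * real (card (?Q m))"
      using rat by (simp only: pos_less_divide_eq less_imp_le)
    moreover have "\<delta> * real (card (?Q m)) \<ge> \<delta> * (c / 2 * real m * 2 ^ m)"
      using Qge \<delta>0 by (intro mult_left_mono) auto
    ultimately have "real (card (?W m)) \<ge> e * real m * 2 ^ m" by (simp add: e_def mult_ac)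
    then have mu: "\<mu> \<ge> e * real m" by (simp add: \<mu>_def pos_le_divide_eq)
    have em: "e * real m > 0" using e0 m1 by simp
    then have mu0: "\<mu> > 0" using mu by linarith
    have "prob_small f (?N m) m (?T m) \<le> 2 / sqrt (\<mu> / 2) + 4 / \<mu>"
      unfolding \<mu>_def
    proof (rule prob_small_le)
      show "?T m > 0" using K_pos by (simp add: Tm_def)
      show "0 < real (card (?W m)) / 2 ^ m" using mu0 by (simp only: \<mu>_def)
    qed (auto simp: Lambda_def)
    also have "\<dots> \<le> 2 / sqrt (e * real m / 2) + 4 / (e * real m)"
      using mu mu0 e0 m1 by (intro add_mono divide_left_mono mult_pos_pos real_sqrt_le_mono) auto
    finally have "sqrt (real m) * prob_small f (?N m) m (?T m)
        \<le> sqrt (real m) * (2 / sqrt (e * real m / 2) + 4 / (e * real m))"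
      by (rule mult_left_mono) simp
    \<comment> \<open>The Littlewood-Offord term decays exactly like \<open>1 / sqrt m\<close> and
      becomes constant; the Chebyshev term is of lower order.\<close>
    also have "\<dots> = 2 / sqrt (e / 2) + 4 / e * (sqrt (real m) / real m)"
      using m1 e0 by (simp add: real_sqrt_mult real_sqrt_divide field_simps)
    also have "\<dots> \<le> 2 / sqrt (e / 2) + 4 / e * 1"
    proof -
      have "sqrt (real m) \<le> real m" using m1 by (intro real_le_lsqrt) (auto simp: power2_eq_square)
      then have "sqrt (real m) / real m \<le> 1" using m1 by simp
      then show ?thesis using e0 by (intro add_left_mono mult_left_mono) auto
    qed
    finally show ?thesis by simp
  qed
  have "limsup (\<lambda>m. ereal (sqrt (real m) * prob_small f (?N m) m (?T m)))
      \<le> ereal (2 / sqrt (e / 2) + 4 / e)"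
    by (rule Limsup_bounded, rule eventually_mono[OF eventually_conj[OF ev eventually_ge_at_top[of "max 1 (nat \<lceil>2 / c\<rceil>)"]]])
      (use bound in auto)
  also have "\<dots> < \<infinity>" by simp
  finally show ?thesis .
qed

end
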